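(* Let $a<0<b$ and let $r,s,f,g,h\in C^1(a,b)$ be real-valued functions. Suppose that for all $x\in(a,b)$ $$r(x)\neq 0,\qquad r'(x)-2h(x)\neq 0,$$ and $$r(x)f(x)-2h(x)s(x)-s'(x)r(x)+s(x)r'(x)=0.$$ Then the planar differential system $$\dot x=r(x)y+s(x),\qquad \dot y=-g(x)-f(x)y-h(x)y^2$$ on $(a,b)\times\mathbb{R}$ is $\sigma$-reversible (that is, $\sigma$ is a reversibility of it), with $$\sigma(x,y)=\left(x,\;2\,\frac{f(x)-s'(x)}{r'(x)-2h(x)}-y\right)=\left(x,\;-\frac{2s(x)}{r(x)}-y\right).$$
   Context: Let $\Omega=(a,b)\times\mathbb{R}$ and let $\phi(t,z)$ denote the local flow on $\Omega$ of the system. An involution of $\Omega$ is a $C^1$ diffeomorphism $\sigma$ of $\Omega$ onto itself with $\sigma(\sigma(z))=z$ for all $z\in\Omega$. An involution $\sigma$ is a reversibility of the system if $\phi(t,\sigma(z))=\sigma(\phi(-t,z))$ for all $t\in\mathbb{R}$ and $z\in\Omega$ such that both sides are defined. *)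

theory Defs
  imports "HOL-Analysis.Analysis"
begin

text \<open>These notions are meant for open \<open>S\<close>, so derivatives are taken in the full space.\<close>

definition C1_map_on ::
  "('a::real_normed_vector \<Rightarrow> 'b::real_normed_vector) \<Rightarrow> 'a set \<Rightarrow> bool" where
  "C1_map_on F S \<longleftrightarrow>
     (\<exists>D :: 'a \<Rightarrow> 'a \<Rightarrow>\<^sub>L 'b.
        (\<forall>z\<in>S. (F has_derivative blinfun_apply (D z)) (at z)) \<and> continuous_on S D)"

definition C1_diffeomorphism ::
  "('a::real_normed_vector \<Rightarrow> 'b::real_normed_vector) \<Rightarrow> 'a set \<Rightarrow> 'b set \<Rightarrow> bool" where
  "C1_diffeomorphism F S T \<longleftrightarrow>
     bij_betw F S T \<and> C1_map_on F S \<and> C1_map_on (inv_into S F) T"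

definition involution_of :: "'a::real_normed_vector set \<Rightarrow> ('a \<Rightarrow> 'a) \<Rightarrow> bool" where
  "involution_of S \<sigma> \<longleftrightarrow> C1_diffeomorphism \<sigma> S S \<and> (\<forall>z\<in>S. \<sigma> (\<sigma> z) = z)"

definition solution_from ::
  "('a::real_normed_vector \<Rightarrow> 'a) \<Rightarrow> 'a set \<Rightarrow> 'a \<Rightarrow> real set \<Rightarrow> (real \<Rightarrow> 'a) \<Rightarrow> bool" where
  "solution_from V S z I u \<longleftrightarrow>
     open I \<and> is_interval I \<and> 0 \<in> I \<and> u 0 = z \<and>
     (\<forall>t\<in>I. u t \<in> S \<and> (u has_vector_derivative V (u t)) (at t))"

text \<open>The maximal interval of existence, as the union of the domains of all solutions
  through \<open>z\<close> that stay in \<open>S\<close>.\<close>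

definition existence_times ::
  "('a::real_normed_vector \<Rightarrow> 'a) \<Rightarrow> 'a set \<Rightarrow> 'a \<Rightarrow> real set" where
  "existence_times V S z = {t. \<exists>I u. solution_from V S z I u \<and> t \<in> I}"

text \<open>The value is only meaningful for \<open>t \<in> existence_times V S z\<close> and for fields \<open>V\<close> whose
  solutions are unique, e.g. \<open>V\<close> of class \<open>C\<^sup>1\<close> on \<open>S\<close>.\<close>

definition local_flow ::
  "('a::real_normed_vector \<Rightarrow> 'a) \<Rightarrow> 'a set \<Rightarrow> real \<Rightarrow> 'a \<Rightarrow> 'a" where
  "local_flow V S t z = (THE p. \<exists>I u. solution_from V S z I u \<and> t \<in> I \<and> u t = p)"

definition reversibility_of ::
  "('a::real_normed_vector \<Rightarrow> 'a) \<Rightarrow> 'a set \<Rightarrow> ('a \<Rightarrow> 'a) \<Rightarrow> bool" where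
  "reversibility_of V S \<sigma> \<longleftrightarrow>
     involution_of S \<sigma> \<and>
     (\<forall>t. \<forall>z\<in>S. t \<in> existence_times V S (\<sigma> z) \<and> - t \<in> existence_times V S z \<longrightarrow>
        local_flow V S t (\<sigma> z) = \<sigma> (local_flow V S (- t) z))"

end

theory Submission
  imports Defs
begin

text \<open>
  The hypothesis forces \<open>(f - s') / (r' - 2 h) = - s / r\<close>, so \<open>\<sigma> (x, y) = (x, q x - y)\<close> with
  \<open>q = - 2 s / r\<close>, and a computation gives \<open>D\<sigma>(z) V(z) = - V(\<sigma> z)\<close>. Hence \<open>t \<mapsto> \<sigma> (u (- t))\<close> is a
  solution through \<open>\<sigma> z\<close> whenever \<open>u\<close> is one through \<open>z\<close>. As \<open>V\<close> is \<open>C\<^sup>1\<close>, hence locally Lipschitz,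
  solutions are unique, so this is the flow through \<open>\<sigma> z\<close>.
\<close>

section \<open>Uniqueness of solutions\<close>

text \<open>The derivative is continuous at \<open>z\<close>, so its operator norm is at most
  \<open>norm (D z) + 1\<close> on a small ball. Balls are convex, so the mean value inequality
  turns this bound into a Lipschitz constant.\<close>

lemma C1_map_on_locally_lipschitz:
  assumes "C1_map_on F S" "open S" "z \<in> S"
  obtains e L where "e > 0" "ball z e \<subseteq> S" "L \<ge> 0"
    "\<And>x y. x \<in> ball z e \<Longrightarrow> y \<in> ball z e \<Longrightarrow> norm (F x - F y) \<le> L * norm (x - y)"
proof -
  obtain D where D: "\<And>z. z \<in> S \<Longrightarrow> (F has_derivative blinfun_apply (D z)) (at z)"
    and cont: "continuous_on S D"
    using assms(1) unfolding C1_map_on_def by blast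
  obtain d where d: "d > 0" "\<And>x. x \<in> S \<Longrightarrow> dist x z < d \<Longrightarrow> dist (D x) (D z) < 1"
    using cont \<open>z \<in> S\<close> unfolding continuous_on_iff by (metis zero_less_one)
  obtain e' where e': "e' > 0" "ball z e' \<subseteq> S"
    using assms open_contains_ball by blast
  define e where "e = min d e'"
  have sub: "ball z e \<subseteq> S" using e' by (auto simp: e_def)
  have bound: "onorm (blinfun_apply (D x)) \<le> norm (D z) + 1" if "x \<in> ball z e" for x
  proof -
    have "dist (D x) (D z) < 1"
      using d(2)[of x] that subsetD[OF sub that] by (simp add: e_def dist_commute)
    then have "norm (D x) \<le> norm (D z) + 1"
      using norm_triangle_sub[of "D x" "D z"] by (simp add: dist_norm)
    then show ?thesis by (simp add: norm_blinfun.rep_eq)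
  qed
  show thesis
  proof (rule that[of e "norm (D z) + 1"])
    show "norm (F x - F y) \<le> (norm (D z) + 1) * norm (x - y)"
      if "x \<in> ball z e" "y \<in> ball z e" for x y
    proof (rule differentiable_bound[OF convex_ball _ bound that])
      show "(F has_derivative blinfun_apply (D x)) (at x within ball z e)"
        if "x \<in> ball z e" for x
        using D sub that by (blast intro: has_derivative_at_withinI)
    qed
  qed (use d e' sub in \<open>auto simp: e_def\<close>)
qed

text \<open>A contraction estimate free of integrals: near \<open>t0\<close> the derivative of
  \<open>u t - w t\<close> is bounded by \<open>L\<close> times the largest difference, and the mean
  value inequality bounds that difference in turn. The neighbourhood is two-sided so that agreement
  is an open condition.\<close>

lemma solutions_agree_near:
  fixes u w :: "real \<Rightarrow> 'a::real_normed_vector"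
  assumes V: "C1_map_on V S" "open S"
    and J: "open J" "t0 \<in> J"
    and u: "\<And>t. t \<in> J \<Longrightarrow> u t \<in> S \<and> (u has_vector_derivative V (u t)) (at t)"
    and w: "\<And>t. t \<in> J \<Longrightarrow> w t \<in> S \<and> (w has_vector_derivative V (w t)) (at t)"
    and eq: "u t0 = w t0"
  obtains d where "d > 0" "\<And>t. \<bar>t - t0\<bar> < d \<Longrightarrow> u t = w t"
proof -
  obtain e L where e: "e > 0" "L \<ge> 0"
    and lip: "\<And>x y. x \<in> ball (u t0) e \<Longrightarrow> y \<in> ball (u t0) e \<Longrightarrow> norm (V x - V y) \<le> L * norm (x - y)"
    using C1_map_on_locally_lipschitz[OF V, of "u t0"] u J by metis
  have isC: "isCont u t0" "isCont w t0"
    using u w J has_vector_derivative_continuous by blast+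
  obtain d1 where d1: "d1 > 0" "\<And>t. dist t t0 < d1 \<Longrightarrow> dist (u t) (u t0) < e"
    using isC(1) e(1) unfolding continuous_at_eps_delta by blast
  obtain d2 where d2: "d2 > 0" "\<And>t. dist t t0 < d2 \<Longrightarrow> dist (w t) (w t0) < e"
    using isC(2) e(1) unfolding continuous_at_eps_delta by blast
  obtain d3 where d3: "d3 > 0" "ball t0 d3 \<subseteq> J"
    using J open_contains_ball by blast
  \<comment> \<open>Halving the radii keeps the closed ball \<open>K\<close> inside the open balls
    obtained above. The last entry ensures \<open>L * d \<le> 1 / 2\<close>, with
    \<open>L + 1\<close> in place of \<open>L\<close> to allow \<open>L = 0\<close>.\<close>
  define d where "d = min (min (d1 / 2) (d2 / 2)) (min (d3 / 2) (1 / (2 * (L + 1))))"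
  have dpos: "d > 0" using d1 d2 d3 e by (auto simp: d_def)
  define K where "K = cball t0 d"
  have near: "t \<in> J" "u t \<in> ball (u t0) e" "w t \<in> ball (u t0) e" if "t \<in> K" for t
  proof -
    have *: "dist t t0 \<le> d" using that by (simp add: K_def dist_commute)
    then have "dist t t0 < d1" "dist t t0 < d2" using d1(1) d2(1) by (auto simp: d_def)
    then show "u t \<in> ball (u t0) e" "w t \<in> ball (u t0) e"
      using d1(2)[of t] d2(2)[of t] eq by (simp_all add: dist_commute)
    have "dist t0 t < d3" using * d3 by (auto simp: d_def dist_commute)
    then show "t \<in> J" using d3 by auto
  qed
  have der: "((\<lambda>t. u t - w t) has_vector_derivative (V (u t) - V (w t))) (at t within K)"
    if "t \<in> K" for t
    using u[of t] w[of t] near[OF that]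
    by (auto intro!: has_vector_derivative_diff intro: has_vector_derivative_at_within)
  then have "continuous_on K (\<lambda>t. u t - w t)"
    using continuous_on_eq_continuous_within has_vector_derivative_continuous by blast
  then have contn: "continuous_on K (\<lambda>t. norm (u t - w t))"
    by (rule continuous_on_norm)
  have "compact K" "K \<noteq> {}" "t0 \<in> K" using dpos by (auto simp: K_def)
  then obtain tm where tm: "tm \<in> K" "\<And>t. t \<in> K \<Longrightarrow> norm (u t - w t) \<le> norm (u tm - w tm)"
    using continuous_attains_sup[OF _ _ contn] by blast
  define M where "M = norm (u tm - w tm)"
  have M0: "M \<ge> 0" by (simp add: M_def)
  \<comment> \<open>The length of \<open>K\<close> is so small that the mean value bound halves the maximal difference \<open>M\<close>.\<close>
  have "norm ((u tm - w tm) - (u t0 - w t0)) \<le> (L * M) * norm (tm - t0)"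
  proof (rule differentiable_bound[of K _ "\<lambda>t h. h *\<^sub>R (V (u t) - V (w t))"])
    show "convex K" by (simp add: K_def)
    show "((\<lambda>t. u t - w t) has_derivative (\<lambda>h. h *\<^sub>R (V (u t) - V (w t)))) (at t within K)"
      if "t \<in> K" for t
      using der[OF that] by (simp add: has_vector_derivative_def)
    show "onorm (\<lambda>h. h *\<^sub>R (V (u t) - V (w t))) \<le> L * M" if "t \<in> K" for t
    proof (rule onorm_bound)
      have "norm (V (u t) - V (w t)) \<le> L * norm (u t - w t)"
        using lip near[OF that] by blast
      also have "\<dots> \<le> L * M"
        unfolding M_def using tm(2)[OF that] e(2) by (rule mult_left_mono)
      finally show "norm (h *\<^sub>R (V (u t) - V (w t))) \<le> L * M * norm h" for h
        by (simp add: mult.commute[of "L * M"] mult_left_mono)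
    qed (use e M0 in simp)
  qed (use tm \<open>t0 \<in> K\<close> in auto)
  then have "M \<le> (L * M) * norm (tm - t0)" using eq by (simp add: M_def)
  also have "\<dots> \<le> (L * M) * (1 / (2 * (L + 1)))"
    by (rule mult_left_mono) (use tm e M0 in \<open>auto simp: K_def d_def dist_norm norm_minus_commute\<close>)
  also have "\<dots> \<le> M / 2"
    using e M0 by (simp add: field_simps)
  finally have "M = 0" using M0 by simp
  then have "u t = w t" if "t \<in> K" for t
    using tm(2)[OF that] by (simp add: M_def)
  then show thesis
    using that[OF dpos] by (force simp: K_def dist_real_def)
qed

text \<open>The set \<open>E\<close> of agreement is open by the local result, closed by continuity
  of the difference, and contains \<open>0\<close>. The common domain, an intersection of intervals,
  is connected, so \<open>E\<close> is all of it.\<close>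

lemma solution_from_unique:
  assumes V: "C1_map_on V S" "open S"
    and u: "solution_from V S z I u" and w: "solution_from V S z J w"
    and t: "t \<in> I" "t \<in> J"
  shows "u t = w t"
proof -
  define K where "K = I \<inter> J"
  define E where "E = {t \<in> K. u t = w t}"
  have K: "open K" "connected K" "0 \<in> K"
    using u w unfolding K_def solution_from_def
    by (auto simp: is_interval_connected_1 [symmetric] is_interval_Int)
  have uK: "\<And>t. t \<in> K \<Longrightarrow> u t \<in> S \<and> (u has_vector_derivative V (u t)) (at t)"
    and wK: "\<And>t. t \<in> K \<Longrightarrow> w t \<in> S \<and> (w has_vector_derivative V (w t)) (at t)"
    using u w by (auto simp: K_def solution_from_def)
  have "open E"
    unfolding open_dist
  proof
    fix t assume "t \<in> E"
    then have tE: "t \<in> K" "u t = w t" by (auto simp: E_def)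
    obtain d where d: "d > 0" "\<And>t'. \<bar>t' - t\<bar> < d \<Longrightarrow> u t' = w t'"
      using solutions_agree_near[OF V K(1) tE(1) uK wK tE(2)] by metis
    obtain d' where d': "d' > 0" "\<And>t'. dist t' t < d' \<Longrightarrow> t' \<in> K"
      using K(1) tE(1) unfolding open_dist by blast
    show "\<exists>e>0. \<forall>y. dist y t < e \<longrightarrow> y \<in> E"
      using d d' by (intro exI[of _ "min d d'"]) (auto simp: E_def dist_real_def)
  qed
  then have op: "openin (top_of_set K) E"
    by (simp add: openin_open_eq[OF K(1)] E_def)
  have "continuous_on K (\<lambda>t. u t - w t)"
    using uK wK
    by (intro continuous_on_diff continuous_at_imp_continuous_on)
       (auto dest: has_vector_derivative_continuous)
  then have cl: "closedin (top_of_set K) E"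
    using continuous_closedin_preimage_constant[of K "\<lambda>t. u t - w t" 0]
    by (simp add: E_def)
  have "0 \<in> E" using K u w by (simp add: E_def solution_from_def)
  then have "E = K"
    using K(2) op cl unfolding connected_clopen by blast
  then show ?thesis using t by (auto simp: E_def K_def)
qed

text \<open>Uniqueness makes the definite description well defined, so any one solution whose domain
  contains \<open>t\<close> computes the flow.\<close>

lemma local_flow_eq:
  assumes "C1_map_on V S" "open S" "solution_from V S z I u" "t \<in> I"
  shows "local_flow V S t z = u t"
  unfolding local_flow_def
  using assms solution_from_unique[OF assms(1,2)] by (intro the_equality) blast+

section \<open>A criterion for reversibility\<close>

text \<open>Two minus signs cancel in the chain rule: one from reversing time, one from
  \<open>anti\<close>.\<close>

lemma solution_from_reverse:
  assumes der: "\<And>z. z \<in> S \<Longrightarrow> (\<sigma> has_derivative D z) (at z)"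
    and anti: "\<And>z. z \<in> S \<Longrightarrow> D z (V z) = - V (\<sigma> z)"
    and maps: "\<And>z. z \<in> S \<Longrightarrow> \<sigma> z \<in> S"
    and u: "solution_from V S z I u"
  shows "solution_from V S (\<sigma> z) (uminus ` I) (\<lambda>t. \<sigma> (u (- t)))"
  unfolding solution_from_def
proof (intro conjI ballI)
  show "open (uminus ` I)" "is_interval (uminus ` I)" "0 \<in> uminus ` I" "\<sigma> (u (- 0)) = \<sigma> z"
    using u by (auto simp: solution_from_def open_negations image_iff)
next
  fix t assume "t \<in> uminus ` I"
  then have "- t \<in> I" by auto
  then have t: "u (- t) \<in> S" "(u has_vector_derivative V (u (- t))) (at (- t))"
    using u by (auto simp: solution_from_def)
  then show "\<sigma> (u (- t)) \<in> S" using maps by blast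
  have "(uminus has_vector_derivative (- 1 :: real)) (at t)"
    by (auto intro!: derivative_eq_intros)
  from vector_diff_chain_at[OF this t(2)]
  have "((\<lambda>t. u (- t)) has_vector_derivative (- 1) *\<^sub>R V (u (- t))) (at t)"
    by (simp add: o_def)
  then have "((\<lambda>t. u (- t)) has_derivative (\<lambda>h. - (h *\<^sub>R V (u (- t))))) (at t)"
    by (simp add: has_vector_derivative_def)
  from has_derivative_compose[OF this der[OF t(1)]]
  have "((\<lambda>t. \<sigma> (u (- t))) has_derivative (\<lambda>h. D (u (- t)) (- (h *\<^sub>R V (u (- t)))))) (at t)" .
  moreover have "linear (D (u (- t)))"
    using der[OF t(1)] has_derivative_linear by blast
  ultimately show "((\<lambda>t. \<sigma> (u (- t))) has_vector_derivative V (\<sigma> (u (- t)))) (at t)"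
    using anti[OF t(1)] by (simp add: has_vector_derivative_def linear_neg linear_scale)
qed

text \<open>The inverse of \<sigma> agrees with \<sigma> on \<open>S\<close>. Since \<open>S\<close>
  is open, this agreement carries the derivative over to \<open>inv_into S \<sigma>\<close>, whose
  values outside \<open>S\<close> are unspecified.\<close>

lemma involution_ofI:
  assumes C1: "C1_map_on \<sigma> S" and "open S"
    and maps: "\<And>z. z \<in> S \<Longrightarrow> \<sigma> z \<in> S" and inv: "\<And>z. z \<in> S \<Longrightarrow> \<sigma> (\<sigma> z) = z"
  shows "involution_of S \<sigma>"
proof -
  have bij: "bij_betw \<sigma> S S"
    using maps inv by (intro bij_betwI[where g = \<sigma>]) auto
  have eq: "\<sigma> z = inv_into S \<sigma> z" if "z \<in> S" for z
    using bij maps inv that by (metis bij_betw_def inv_into_f_f)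
  obtain D where D: "\<And>z. z \<in> S \<Longrightarrow> (\<sigma> has_derivative blinfun_apply (D z)) (at z)"
    and cont: "continuous_on S D"
    using C1 unfolding C1_map_on_def by blast
  have "(inv_into S \<sigma> has_derivative blinfun_apply (D z)) (at z)"
    if "z \<in> S" for z
    using has_derivative_transform_within_open[OF D[OF that] \<open>open S\<close> that eq] .
  then have "C1_map_on (inv_into S \<sigma>) S"
    using cont unfolding C1_map_on_def by blast
  then show ?thesis
    using bij C1 inv by (simp add: involution_of_def C1_diffeomorphism_def)
qed

text \<open>A solution through \<open>z\<close> defined at \<open>- t\<close> reverses to one
  through \<open>\<sigma> z\<close> defined at \<open>t\<close>, and both flow values are read off
  from these two curves.\<close>

lemma reversibility_ofI:
  assumes V: "C1_map_on V S" "open S" and \<sigma>: "involution_of S \<sigma>"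
    and der: "\<And>z. z \<in> S \<Longrightarrow> (\<sigma> has_derivative D z) (at z)"
    and anti: "\<And>z. z \<in> S \<Longrightarrow> D z (V z) = - V (\<sigma> z)"
  shows "reversibility_of V S \<sigma>"
  unfolding reversibility_of_def
proof (intro conjI allI ballI impI)
  fix t z assume "z \<in> S" "t \<in> existence_times V S (\<sigma> z) \<and> - t \<in> existence_times V S z"
  then obtain I u where u: "solution_from V S z I u" "- t \<in> I"
    unfolding existence_times_def by blast
  have maps: "\<sigma> z \<in> S" if "z \<in> S" for z
    using \<sigma> that unfolding involution_of_def C1_diffeomorphism_def by (auto dest: bij_betw_apply)
  have "t \<in> uminus ` I" using u(2) by (metis image_eqI minus_minus)
  then show "local_flow V S t (\<sigma> z) = \<sigma> (local_flow V S (- t) z)"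
    using local_flow_eq[OF V solution_from_reverse[OF der anti maps u(1)]] local_flow_eq[OF V u]
    by simp
qed (rule \<sigma>)

section \<open>The planar system\<close>

text \<open>\<open>A\<close>, \<open>B\<close>, \<open>C\<close>, \<open>E\<close> are the entries
  of the Jacobian matrix. Writing the derivative as their combination of four constant matrix units
  reduces continuity in operator norm to continuity of the entries.\<close>

lemma C1_map_on_plane:
  fixes F :: "real \<times> real \<Rightarrow> real \<times> real"
  assumes der: "\<And>z. z \<in> S \<Longrightarrow> (F has_derivative
      (\<lambda>v. (A z * fst v + B z * snd v, C z * fst v + E z * snd v))) (at z)"
    and cont: "continuous_on S A" "continuous_on S B" "continuous_on S C" "continuous_on S E"
  shows "C1_map_on F S"
proof -
  define e1 e2 e3 e4 :: "(real \<times> real) \<Rightarrow>\<^sub>L (real \<times> real)"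
    where "e1 = Blinfun (\<lambda>v. (fst v, 0))" and "e2 = Blinfun (\<lambda>v. (snd v, 0))"
      and "e3 = Blinfun (\<lambda>v. (0, fst v))" and "e4 = Blinfun (\<lambda>v. (0, snd v))"
  define D where "D z = A z *\<^sub>R e1 + B z *\<^sub>R e2 + C z *\<^sub>R e3 + E z *\<^sub>R e4" for z
  have e: "blinfun_apply e1 v = (fst v, 0)" "blinfun_apply e2 v = (snd v, 0)"
     "blinfun_apply e3 v = (0, fst v)" "blinfun_apply e4 v = (0, snd v)" for v
    unfolding e1_def e2_def e3_def e4_def
    by (subst bounded_linear_Blinfun_apply;
        auto intro!: bounded_linear_Pair bounded_linear_fst bounded_linear_snd bounded_linear_zero)+
  have "blinfun_apply (D z) = (\<lambda>v. (A z * fst v + B z * snd v, C z * fst v + E z * snd v))" for z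
    by (rule ext) (simp add: D_def blinfun.add_left blinfun.scaleR_left e)
  moreover have "continuous_on S D"
    unfolding D_def by (intro continuous_intros cont)
  ultimately show ?thesis
    unfolding C1_map_on_def using der by (intro exI[of _ D]) auto
qed

lemma C1_differentiable_onE:
  fixes p :: "real \<Rightarrow> real"
  assumes "p C1_differentiable_on S"
  shows "\<And>x. x \<in> S \<Longrightarrow> (p has_real_derivative deriv p x) (at x)"
    and "continuous_on S p" and "continuous_on S (deriv p)"
proof -
  obtain D where D: "\<And>x. x \<in> S \<Longrightarrow> (p has_real_derivative D x) (at x)" "continuous_on S D"
    using assms unfolding C1_differentiable_on_def
    by (auto simp: has_real_derivative_iff_has_vector_derivative)
  then have eq: "deriv p x = D x" if "x \<in> S" for x
    using that DERIV_imp_deriv by blast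
  show "(p has_real_derivative deriv p x) (at x)" if "x \<in> S" for x
    using D eq that by simp
  show "continuous_on S (deriv p)"
    using D(2) eq by (simp cong: continuous_on_cong)
  show "continuous_on S p"
    using assms by (rule C1_differentiable_imp_continuous_on)
qed

theorem theorem2:
  fixes a b :: real and r s f g h :: "real \<Rightarrow> real"
    and V \<sigma> :: "real \<times> real \<Rightarrow> real \<times> real"
  assumes "a < 0" and "0 < b"
    and "r C1_differentiable_on {a<..<b}"
    and "s C1_differentiable_on {a<..<b}"
    and "f C1_differentiable_on {a<..<b}"
    and "g C1_differentiable_on {a<..<b}"
    and "h C1_differentiable_on {a<..<b}"
    and "\<And>x. x \<in> {a<..<b} \<Longrightarrow> r x \<noteq> 0"
    and "\<And>x. x \<in> {a<..<b} \<Longrightarrow> deriv r x - 2 * h x \<noteq> 0"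
    and "\<And>x. x \<in> {a<..<b} \<Longrightarrow>
           r x * f x - 2 * h x * s x - deriv s x * r x + s x * deriv r x = 0"
    and V: "V = (\<lambda>(x, y). (r x * y + s x, - g x - f x * y - h x * y\<^sup>2))"
    and \<sigma>: "\<sigma> = (\<lambda>(x, y). (x, 2 * ((f x - deriv s x) / (deriv r x - 2 * h x)) - y))"
  shows "reversibility_of V ({a<..<b} \<times> UNIV) \<sigma> \<and>
         (\<forall>x\<in>{a<..<b}. \<forall>y. \<sigma> (x, y) = (x, - (2 * s x / r x) - y))"
proof -
  let ?I = "{a<..<b}"
  let ?S = "?I \<times> (UNIV :: real set)"
  note r = C1_differentiable_onE[OF assms(3)] and s = C1_differentiable_onE[OF assms(4)]
    and f = C1_differentiable_onE[OF assms(5)] and g = C1_differentiable_onE[OF assms(6)]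
    and h = C1_differentiable_onE[OF assms(7)]
  note r0 = assms(8) and d0 = assms(9) and rel = assms(10)
  \<comment> \<open>Half of \<open>q x\<close> is the height at which the first component of
    \<open>V\<close> vanishes; \<sigma> reflects each vertical line in that point.\<close>
  define q where "q x = - (2 * s x / r x)" for x
  define q' where "q' x = - 2 * (deriv s x * r x - s x * deriv r x) / (r x)\<^sup>2" for x
  have S: "open ?S" by (simp add: open_Times)
  have fst_cont: "continuous_on ?S (\<lambda>z. p (fst z))" if "continuous_on ?I p" for p :: "real \<Rightarrow> real"
    by (rule continuous_on_compose2[OF that]) (auto intro: continuous_intros)
  have \<sigma>_eq: "\<sigma> (x, y) = (x, q x - y)" if "x \<in> ?I" for x y
  proof -
    \<comment> \<open>This is \<open>rel\<close> rearranged into the cross-multiplied form of the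
      equality of the two fractions.\<close>
    have "r x * (f x - deriv s x) = - s x * (deriv r x - 2 * h x)"
      using rel[OF that] by (simp add: algebra_simps)
    then have "(f x - deriv s x) / (deriv r x - 2 * h x) = - s x / r x"
      using r0[OF that] d0[OF that] by (subst frac_eq_eq) (auto simp: mult.commute)
    then have "2 * ((f x - deriv s x) / (deriv r x - 2 * h x)) = q x"
      unfolding q_def by (simp only:)
    then show ?thesis unfolding \<sigma> by simp
  qed
  have q: "(q has_real_derivative q' x) (at x)" if "x \<in> ?I" for x
    unfolding q_def
    by (rule derivative_eq_intros r s that r0 refl)+
       (use r0[OF that] in \<open>simp add: q'_def field_simps power2_eq_square\<close>)
  define D where "D z v = (fst v, q' (fst z) * fst v - snd v)" for z v :: "real \<times> real"
  have \<sigma>_der: "(\<sigma> has_derivative D z) (at z)" if "z \<in> ?S" for z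
  \<comment> \<open>The formula with \<open>q\<close> is only known for \<sigma> over the interval,
    so the derivative is computed for the formula and transferred along the open strip.\<close>
  proof (rule has_derivative_transform_within_open[OF _ S that])
    have "((\<lambda>z. q (fst z)) has_derivative (\<lambda>v. fst v * q' (fst z))) (at z)"
      by (rule DERIV_compose_FDERIV) (use q that in \<open>auto intro: derivative_intros\<close>)
    then show "((\<lambda>z. (fst z, q (fst z) - snd z)) has_derivative D z) (at z)"
      unfolding D_def by (auto intro!: derivative_eq_intros simp: mult.commute)
  qed (auto simp: \<sigma>_eq)
  have \<sigma>_C1: "C1_map_on \<sigma> ?S"
  proof (rule C1_map_on_plane[where A = "\<lambda>_. 1" and B = "\<lambda>_. 0"
        and C = "\<lambda>z. q' (fst z)" and E = "\<lambda>_. - 1"])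
    show "(\<sigma> has_derivative (\<lambda>v. (1 * fst v + 0 * snd v, q' (fst z) * fst v + - 1 * snd v))) (at z)"
      if "z \<in> ?S" for z
      using \<sigma>_der[OF that] unfolding D_def by simp
    have "continuous_on ?I q'"
      unfolding q'_def by (intro continuous_intros r s) (use r0 in auto)
    then show "continuous_on ?S (\<lambda>z. q' (fst z))" by (rule fst_cont)
  qed auto
  have inv: "involution_of ?S \<sigma>"
    by (rule involution_ofI[OF \<sigma>_C1 S]) (auto simp: \<sigma>_eq)
  have V_C1: "C1_map_on V ?S"
  \<comment> \<open>The entries are the partial derivatives of the two components of
    \<open>V\<close>.\<close>
  proof (rule C1_map_on_plane[where A = "\<lambda>z. deriv r (fst z) * snd z + deriv s (fst z)"
        and B = "\<lambda>z. r (fst z)"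
        and C = "\<lambda>z. - deriv g (fst z) - deriv f (fst z) * snd z - deriv h (fst z) * (snd z)\<^sup>2"
        and E = "\<lambda>z. - f (fst z) - 2 * h (fst z) * snd z"])
    fix z assume z: "z \<in> ?S"
    have comp: "((\<lambda>z. p (fst z)) has_derivative (\<lambda>v. fst v * deriv p (fst z))) (at z)"
      if "\<And>x. x \<in> ?I \<Longrightarrow> (p has_real_derivative deriv p x) (at x)" for p
      by (rule DERIV_compose_FDERIV) (use that z in \<open>auto intro: derivative_intros\<close>)
    show "(V has_derivative (\<lambda>v.
        ((deriv r (fst z) * snd z + deriv s (fst z)) * fst v + r (fst z) * snd v,
         (- deriv g (fst z) - deriv f (fst z) * snd z - deriv h (fst z) * (snd z)\<^sup>2) * fst v
           + (- f (fst z) - 2 * h (fst z) * snd z) * snd v))) (at z)"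
      unfolding V case_prod_beta
      by (rule derivative_eq_intros comp r s f g h refl | assumption)+
         (auto simp: fun_eq_iff algebra_simps)
  qed (intro continuous_intros fst_cont r s f g h)+
  have anti: "D z (V z) = - V (\<sigma> z)" if "z \<in> ?S" for z
  proof -
    obtain x y where z: "z = (x, y)" by force
    then have x: "x \<in> ?I" using that by simp
    have sq: "s x = - (q x * r x) / 2" using r0[OF x] by (simp add: q_def)
    \<comment> \<open>Multiplied by \<open>r x\<close>, the factor that controls the second
      component becomes twice the left side of \<open>rel\<close>.\<close>
    have "r x * (q' x * r x + 2 * f x + 2 * h x * q x)
        = 2 * (r x * f x - 2 * h x * s x - deriv s x * r x + s x * deriv r x)"
      using r0[OF x] by (simp add: q_def q'_def field_simps power2_eq_square)
    then have lin: "q' x * r x + 2 * f x + 2 * h x * q x = 0"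
      using rel[OF x] r0[OF x] by simp
    \<comment> \<open>The left side is the second component of
      \<open>D z (V z) + V (\<sigma> z)\<close>, where \<open>g\<close> and the terms in
      \<open>y\<^sup>2\<close> have cancelled. With \<open>s\<close> replaced through
      \<open>sq\<close>, it is divisible by \<open>y - q x / 2\<close>.\<close>
    have "q' x * (r x * y + s x) + 2 * f x * y - f x * q x - h x * (q x)\<^sup>2 + 2 * h x * q x * y
        = (y - q x / 2) * (q' x * r x + 2 * f x + 2 * h x * q x)"
      unfolding sq by (simp add: field_simps power2_eq_square)
    then have "q' x * (r x * y + s x) + 2 * f x * y - f x * q x - h x * (q x)\<^sup>2 + 2 * h x * q x * y = 0"
      using lin by simp
    then have "q' x * (r x * y + s x) - (- g x - f x * y - h x * y\<^sup>2)
        = - (- g x - f x * (q x - y) - h x * (q x - y)\<^sup>2)"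
      by (simp add: algebra_simps power2_eq_square)
    \<comment> \<open>By \<open>sq\<close>, the first component of \<open>V\<close> is
      \<open>r x * (y - q x / 2)\<close>, which is odd under the reflection.\<close>
    moreover have "r x * y + s x = - (r x * (q x - y) + s x)"
      unfolding sq by (simp add: field_simps)
    ultimately show ?thesis
      unfolding z \<sigma>_eq[OF x] D_def V by (simp only: case_prod_conv fst_conv snd_conv uminus_Pair)
  qed
  show ?thesis
    using reversibility_ofI[OF V_C1 S inv \<sigma>_der anti] \<sigma>_eq by (simp add: q_def)
qed

end
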